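(* Let $\gamma=\mathrm{diag}(\alpha,\alpha^{-1})$ with $\alpha\in\mathcal O^\times$. If $\alpha\not\equiv\pm1\pmod{\mathfrak p}$, then $S(\gamma)^{-1}$ is not $\varepsilon$-conjugate to any element of $C$.
   Context: $F$ is a $p$-adic field of characteristic zero, $\mathcal O$ its ring of integers, $\mathfrak p$ its maximal ideal, $\varpi$ a uniformizer. $G=GL_2(F)$, $w=\begin{pmatrix}0&1\\1&0\end{pmatrix}$, $g^{\vdash}=w\,{}^tg\,w$. Elements $X,Y\in G$ are $\varepsilon$-conjugate if $Y=gXg^{\vdash}$ for some $g\in G$. $S(\gamma)=\gamma-I=\mathrm{diag}(\alpha-1,\alpha^{-1}-1)$. Let $E=F(\sqrt\varpi)$, embedded in $M_2(F)$ with $\varpi_E=\sqrt\varpi=\begin{pmatrix}0&1\\\varpi&0\end{pmatrix}$. Let $\mathcal L$ be a compact open subgroup of $G$ contained in $I_1=\begin{pmatrix}1+\mathfrak p&\mathcal O\\\mathfrak p&1+\mathfrak p\end{pmatrix}$ such that $G'=E^\times\mathcal L$ is a subgroup (the inducing subgroup in Kutzko's construction of a supercuspidal representation of $G$ by compact induction of a character of $G'$). Put $C_0=\mathcal O_E^\times\mathcal L$ and $C=C_0\cup\varpi_EC_0$; $C$ is the support of the function $f_G$ obtained by restricting to $C$ the extension by zero of that character. *)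

theory Defs
  imports "HOL-Analysis.Analysis" "HOL-Algebra.Coset"
begin

text \<open>
  A p-adic field of characteristic zero: a field of characteristic zero, complete with respect to
  a discrete nontrivial non-archimedean absolute value, with finite residue field.  The absolute
  value (not required to be normalized) induces the metric, and hence the topology on the field
  and the product topology on matrices.  The library's \<open>norm\<close> is not used for it because that
  constant is constrained to real normed vector spaces.
\<close>

class p_adic_field = field_char_0 + complete_space +
  fixes absval :: "'a \<Rightarrow> real"
  assumes dist_absval: "dist x y = absval (x - y)"
    and absval_mult: "absval (x * y) = absval x * absval y"
    and absval_ultrametric: "absval (x + y) \<le> max (absval x) (absval y)"
    and maximal_ideal_principal:
      "\<exists>\<pi>. \<pi> \<noteq> 0 \<and> {x. absval x < 1} = (\<lambda>x. \<pi> * x) ` {x. absval x \<le> 1}"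
    and finite_residue_field:
      "finite ((\<lambda>c. (\<lambda>x. c + x) ` {x. absval x < 1}) ` {c. absval c \<le> 1})"

definition int_ring :: "'a::p_adic_field set" (\<open>\<O>\<close>)
  where "\<O> = {x. absval x \<le> 1}"

definition max_ideal :: "'a::p_adic_field set" (\<open>\<pp>\<close>)
  where "\<pp> = {x. absval x < 1}"

definition int_units :: "'a::p_adic_field set"
  where "int_units = {x \<in> \<O>. \<exists>y\<in>\<O>. x * y = 1}"

definition uniformizer :: "'a::p_adic_field \<Rightarrow> bool"
  where "uniformizer \<pi> \<longleftrightarrow> \<pi> \<noteq> 0 \<and> \<pp> = (\<lambda>x. \<pi> * x) ` \<O>"

type_synonym 'a mat22 = "'a^2^2"

definition mat2 :: "'a::zero \<Rightarrow> 'a \<Rightarrow> 'a \<Rightarrow> 'a \<Rightarrow> 'a mat22"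
  where "mat2 a b c d = vector [vector [a, b], vector [c, d]]"

lemma mat2_nth [simp]:
  "mat2 a b c d $ 1 $ 1 = a" "mat2 a b c d $ 1 $ 2 = b"
  "mat2 a b c d $ 2 $ 1 = c" "mat2 a b c d $ 2 $ 2 = d"
  by (simp_all add: mat2_def)

definition mult_monoid :: "('a::field mat22) set \<Rightarrow> ('a mat22) monoid"
  where "mult_monoid R = \<lparr>carrier = R, mult = (**), one = mat 1\<rparr>"

definition GL2 :: "('a::field mat22) monoid"
  where "GL2 = mult_monoid {A. invertible A}"

lemma group_GL2: "group GL2"
proof (rule groupI)
  fix x y z :: "'a mat22"
  assume "x \<in> carrier GL2" "y \<in> carrier GL2" "z \<in> carrier GL2"
  then show "x \<otimes>\<^bsub>GL2\<^esub> y \<in> carrier GL2"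
    and "x \<otimes>\<^bsub>GL2\<^esub> y \<otimes>\<^bsub>GL2\<^esub> z = x \<otimes>\<^bsub>GL2\<^esub> (y \<otimes>\<^bsub>GL2\<^esub> z)"
    by (auto simp: GL2_def mult_monoid_def invertible_mult matrix_mul_assoc)
next
  fix x :: "'a mat22"
  assume "x \<in> carrier GL2"
  then show "\<exists>y\<in>carrier GL2. y \<otimes>\<^bsub>GL2\<^esub> x = \<one>\<^bsub>GL2\<^esub>"
    unfolding GL2_def mult_monoid_def by (auto simp: invertible_def)
qed (auto simp: GL2_def mult_monoid_def invertible_def)

definition w :: "'a::field mat22"
  where "w = mat2 0 1 1 0"

definition vdash :: "'a::field mat22 \<Rightarrow> 'a mat22"
  where "vdash g = w ** transpose g ** w"

definition eps_conjugate :: "'a::field mat22 \<Rightarrow> 'a mat22 \<Rightarrow> bool"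
  where "eps_conjugate X Y \<longleftrightarrow>
    X \<in> carrier GL2 \<and> Y \<in> carrier GL2 \<and> (\<exists>g\<in>carrier GL2. Y = g ** X ** vdash g)"

definition S :: "'a::field mat22 \<Rightarrow> 'a mat22"
  where "S \<gamma> = \<gamma> - mat 1"

definition varpi_E :: "'a::p_adic_field \<Rightarrow> 'a mat22"
  where "varpi_E \<pi> = mat2 0 1 \<pi> 0"

text \<open>The image of \<open>E = F(\<surd>\<pi>)\<close> in the matrix ring, with \<open>\<surd>\<pi>\<close> sent to \<open>varpi_E \<pi>\<close>.\<close>

definition ext_E :: "'a::p_adic_field \<Rightarrow> ('a mat22) set"
  where "ext_E \<pi> = {mat a + mat b ** varpi_E \<pi> | a b. True}"

text \<open>
  The ring of integers of \<open>E\<close>, as the integral closure of \<open>\<O>\<close> in \<open>E\<close>.  Matrix powers are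
  iterated products, because \<open>^\<close> on the vector types would be componentwise.
\<close>

definition integral_over_int_ring :: "'a::p_adic_field mat22 \<Rightarrow> bool"
  where "integral_over_int_ring A \<longleftrightarrow>
    (\<exists>n c. (\<forall>i<n. c i \<in> \<O>) \<and>
      (((**) A) ^^ n) (mat 1) + (\<Sum>i<n. mat (c i) ** (((**) A) ^^ i) (mat 1)) = 0)"

definition int_ring_E :: "'a::p_adic_field \<Rightarrow> ('a mat22) set"
  where "int_ring_E \<pi> = {A \<in> ext_E \<pi>. integral_over_int_ring A}"

definition E_units :: "'a::p_adic_field \<Rightarrow> ('a mat22) set"
  where "E_units \<pi> = Units (mult_monoid (ext_E \<pi>))"

definition int_units_E :: "'a::p_adic_field \<Rightarrow> ('a mat22) set"
  where "int_units_E \<pi> = Units (mult_monoid (int_ring_E \<pi>))"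

definition I1 :: "('a::p_adic_field mat22) set"
  where "I1 = {mat2 a b c d | a b c d. a - 1 \<in> \<pp> \<and> b \<in> \<O> \<and> c \<in> \<pp> \<and> d - 1 \<in> \<pp>}"

definition C0 :: "'a::p_adic_field \<Rightarrow> ('a mat22) set \<Rightarrow> ('a mat22) set"
  where "C0 \<pi> L = int_units_E \<pi> <#>\<^bsub>GL2\<^esub> L"

definition C :: "'a::p_adic_field \<Rightarrow> ('a mat22) set \<Rightarrow> ('a mat22) set"
  where "C \<pi> L = C0 \<pi> L \<union> (varpi_E \<pi> <#\<^bsub>GL2\<^esub> C0 \<pi> L)"

text \<open>
  \<open>matrix_inv\<close> is a genuine inverse only on invertible matrices; the next lemma shows that
  \<open>S \<gamma>\<close> is invertible for the \<open>\<gamma>\<close> of interest.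
\<close>

lemma invertible_S:
  fixes \<alpha> :: "'a::p_adic_field"
  assumes "\<alpha> \<in> int_units" and "\<alpha> - 1 \<notin> \<pp>"
  shows "invertible (S (mat2 \<alpha> 0 0 (inverse \<alpha>)))"
proof -
  have "absval (0::'a) = 0"
    by (metis dist_absval dist_self diff_self)
  then have "\<alpha> \<noteq> 1"
    using assms(2) by (auto simp: max_ideal_def)
  moreover have "\<alpha> \<noteq> 0"
    using assms(1) by (auto simp: int_units_def)
  ultimately have "(\<alpha> - 1) * (inverse \<alpha> - 1) \<noteq> 0"
    by (simp add: inverse_eq_1_iff)
  then show ?thesis
    by (simp add: invertible_det_nz det_2 S_def mat_def)
qed

end

theory Submission
  imports Defs
begin

text \<open>
  If \<open>Y = g X g\<^sup>\<turnstile>\<close> with \<open>X = diag(x, x')\<close> and \<open>D = det g\<close>, then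
  \<open>Y\<^sub>1\<^sub>1 - Y\<^sub>2\<^sub>2 = D (x - x')\<close> and \<open>det Y = D\<^sup>2 x x'\<close>.  For \<open>X = S(\<gamma>)\<^sup>-\<^sup>1\<close> the
  factors \<open>x - x' = (\<alpha> + 1)/(\<alpha> - 1)\<close> and \<open>x x' = -\<alpha>/(\<alpha> - 1)\<^sup>2\<close> are units.  On \<open>C\<^sub>0\<close> the determinant is
  a unit while the diagonal entries agree modulo \<open>\<pp>\<close>, so \<open>D\<close> would be both a unit and in \<open>\<pp>\<close>;
  on the other coset the determinant has valuation 1, which is odd.
\<close>

section \<open>The absolute value\<close>

lemma absval_nonneg: "0 \<le> absval (x::'a::p_adic_field)"
  using dist_absval[of x 0] by (metis diff_zero zero_le_dist)

lemma absval_eq_0_iff [simp]: "absval (x::'a::p_adic_field) = 0 \<longleftrightarrow> x = 0"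
  using dist_absval[of x 0] by (metis diff_zero dist_eq_0_iff)

lemma absval_0 [simp]: "absval (0::'a::p_adic_field) = 0"
  by simp

lemma absval_pos_iff: "0 < absval (x::'a::p_adic_field) \<longleftrightarrow> x \<noteq> 0"
  using absval_nonneg[of x] by (metis absval_eq_0_iff less_eq_real_def less_irrefl)

lemma absval_1 [simp]: "absval (1::'a::p_adic_field) = 1"
  using absval_mult[of "1::'a" 1] absval_eq_0_iff[of "1::'a"] by simp

lemma absval_minus [simp]: "absval (- x) = absval (x::'a::p_adic_field)"
  using dist_absval[of x 0] dist_absval[of 0 x] by (simp add: dist_commute)

lemma absval_diff: "absval (x - y) \<le> max (absval x) (absval (y::'a::p_adic_field))"
  using absval_ultrametric[of x "- y"] by simp

lemma absval_power: "absval (x ^ n) = absval (x::'a::p_adic_field) ^ n"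
  by (induction n) (auto simp: absval_mult)

lemma absval_divide: "absval (x / y) = absval x / absval (y::'a::p_adic_field)"
proof (cases "y = 0")
  case False
  then show ?thesis
    using absval_mult[of "x / y" y] by (simp add: field_simps)
qed simp

text \<open>If \<open>absval (x - y)\<close> fell below \<open>absval y\<close>, then
  \<open>y = x - (x - y)\<close> would be smaller than itself by the ultrametric inequality.\<close>

lemma absval_diff_eq:
  fixes x y :: "'a::p_adic_field"
  assumes "absval x < absval y"
  shows "absval (x - y) = absval y" "absval (y - x) = absval y"
proof -
  show "absval (x - y) = absval y"
    using absval_diff[of x y] absval_diff[of x "x - y"] assms by (auto simp: max_def split: if_splits)
  then show "absval (y - x) = absval y"
    using absval_minus[of "x - y"] by simp
qed

lemma absval_int_units: "x \<in> int_units \<Longrightarrow> absval (x::'a::p_adic_field) = 1"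
proof -
  assume "x \<in> int_units"
  then obtain y where "absval x \<le> 1" "absval y \<le> 1" and xy: "x * y = 1"
    by (auto simp: int_units_def int_ring_def)
  moreover have "absval x * absval y = 1"
    using xy by (simp flip: absval_mult)
  ultimately show ?thesis
    using mult_left_le[of "absval y" "absval x"] absval_nonneg[of x] by auto
qed

text \<open>Discreteness enters here: the third claim says that no absolute value lies strictly
  between that of \<pi> and 1.\<close>

lemma uniformizer_absval:
  fixes \<pi> x :: "'a::p_adic_field"
  assumes "uniformizer \<pi>"
  shows "0 < absval \<pi>" "absval \<pi> < 1" "absval x < 1 \<Longrightarrow> absval x \<le> absval \<pi>"
proof -
  have ideal: "{x. absval x < 1} = (\<lambda>x. \<pi> * x) ` {x. absval x \<le> 1}"
    using assms by (simp add: uniformizer_def max_ideal_def int_ring_def)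
  show "0 < absval \<pi>"
    using assms by (simp add: uniformizer_def absval_pos_iff)
  have "\<pi> * 1 \<in> (\<lambda>x. \<pi> * x) ` {x. absval x \<le> 1}"
    by (rule imageI) simp
  with ideal show "absval \<pi> < 1"
    by auto
  assume "absval x < 1"
  then obtain z where "x = \<pi> * z" "absval z \<le> 1"
    using ideal by blast
  then show "absval x \<le> absval \<pi>"
    using absval_nonneg[of \<pi>] by (simp add: absval_mult mult_left_le)
qed

text \<open>This states that \<pi> has odd valuation without a normalized valuation. A square root
  of its absolute value would be below 1, hence at most \<open>absval \<pi>\<close>, and its square
  would then be strictly too small.\<close>

lemma absval_power2_neq_uniformizer:
  fixes \<pi> z :: "'a::p_adic_field"
  assumes "uniformizer \<pi>"
  shows "(absval z)\<^sup>2 \<noteq> absval \<pi>"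
proof
  note u = uniformizer_absval[OF assms]
  assume eq: "(absval z)\<^sup>2 = absval \<pi>"
  then have "absval z < 1"
    using u(2) by (metis abs_square_less_1 abs_of_nonneg absval_nonneg)
  then have "(absval z)\<^sup>2 \<le> (absval \<pi>)\<^sup>2"
    using u(3) absval_nonneg by (intro power_mono) auto
  also have "\<dots> < absval \<pi>"
    using u(1,2) by (simp add: power2_eq_square)
  finally show False
    using eq by simp
qed

section \<open>Integers of the ramified extension\<close>

lemma mat22_eq_iff:
  "A = B \<longleftrightarrow> A$1$1 = B$1$1 \<and> A$1$2 = B$1$2 \<and> A$2$1 = B$2$1 \<and> A$2$2 = B$2$2"
  for A B :: "'a mat22"
  by (auto simp: vec_eq_iff forall_2)

lemma mat22_mult_nth:
  "(A ** B)$i$j = A$i$1 * B$1$j + A$i$2 * B$2$j" for A B :: "'a::semiring_1 mat22"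
  by (simp add: matrix_matrix_mult_def sum_2)

lemma mat_nth: "(mat c :: 'a::zero^'n^'n)$i$j = (if i = j then c else 0)"
  by (simp add: mat_def)

text \<open>The element x + y \<open>varpi_E \<pi>\<close> has first row (x, y), which determines
  the second row. Membership in E thus becomes two equations in the entries, and \<open>det\<close>
  is the norm from E to F.\<close>

lemma ext_E_iff:
  "A \<in> ext_E \<pi> \<longleftrightarrow> A$2$1 = \<pi> * A$1$2 \<and> A$2$2 = A$1$1"
proof
  assume "A \<in> ext_E \<pi>"
  then show "A$2$1 = \<pi> * A$1$2 \<and> A$2$2 = A$1$1"
    by (auto simp: ext_E_def varpi_E_def mat22_mult_nth mat_nth)
next
  assume "A$2$1 = \<pi> * A$1$2 \<and> A$2$2 = A$1$1"
  then have "A = mat (A$1$1) + mat (A$1$2) ** varpi_E \<pi>"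
    by (simp add: varpi_E_def mat22_eq_iff mat22_mult_nth mat_nth)
  then show "A \<in> ext_E \<pi>"
    unfolding ext_E_def by blast
qed

lemma ext_E_mult: "A \<in> ext_E \<pi> \<Longrightarrow> B \<in> ext_E \<pi> \<Longrightarrow> A ** B \<in> ext_E \<pi>"
  by (simp add: ext_E_iff mat22_mult_nth algebra_simps)

lemma ext_E_power: "A \<in> ext_E \<pi> \<Longrightarrow> (((**) A) ^^ n) (mat 1) \<in> ext_E \<pi>"
  by (induction n) (simp_all add: ext_E_mult, simp add: ext_E_iff mat_nth)

lemma det_matrix_power: "det ((((**) A) ^^ n) (mat 1)) = det A ^ n" for A :: "'a::field mat22"
  by (induction n) (simp_all add: det_mul)

text \<open>The two terms of the norm \<open>x\<^sup>2 - \<pi> y\<^sup>2\<close> have valuations of different parity.\<close>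

lemma absval_det_ext_E:
  fixes \<pi> :: "'a::p_adic_field"
  assumes "uniformizer \<pi>" and A: "A \<in> ext_E \<pi>"
  shows "absval (det A) = max ((absval (A$1$1))\<^sup>2) (absval \<pi> * (absval (A$1$2))\<^sup>2)"
proof -
  let ?x = "A$1$1" and ?y = "A$1$2"
  have det: "det A = ?x\<^sup>2 - \<pi> * ?y\<^sup>2"
    using A by (simp add: ext_E_iff det_2 power2_eq_square algebra_simps)
  have val: "absval (?x\<^sup>2) = (absval ?x)\<^sup>2" "absval (\<pi> * ?y\<^sup>2) = absval \<pi> * (absval ?y)\<^sup>2"
    by (simp_all add: absval_mult absval_power)
  show ?thesis
  proof (cases "?y = 0")
    case True
    then show ?thesis by (simp add: det absval_power)
  next
    case False
    \<comment> \<open>Equality would make the square of \<open>absval (?x / ?y)\<close> equal to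
      \<open>absval \<pi>\<close>.\<close>
    then have "absval (?x\<^sup>2) \<noteq> absval (\<pi> * ?y\<^sup>2)"
      using absval_power2_neq_uniformizer[OF assms(1), of "?x / ?y"]
      by (simp add: val absval_divide power_divide field_simps)
    then show ?thesis
      using absval_diff_eq[of "?x\<^sup>2" "\<pi> * ?y\<^sup>2"] absval_diff_eq[of "\<pi> * ?y\<^sup>2" "?x\<^sup>2"]
      unfolding det val[symmetric] by (cases "absval (?x\<^sup>2) < absval (\<pi> * ?y\<^sup>2)") auto
  qed
qed

lemma absval_det_ext_E_le_iff:
  fixes \<pi> :: "'a::p_adic_field"
  assumes "uniformizer \<pi>" and "A \<in> ext_E \<pi>"
  shows "absval (det A) \<le> r \<longleftrightarrow> (absval (A$1$1))\<^sup>2 \<le> r \<and> absval \<pi> * (absval (A$1$2))\<^sup>2 \<le> r"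
  using absval_det_ext_E[OF assms] by simp

text \<open>The weight \<open>k\<close> serves the two coordinates of E: it is 1 for the first and
  \<open>absval \<pi>\<close> for the second.\<close>

lemma absval_power2_add_le:
  fixes x y :: "'a::p_adic_field"
  assumes "k * (absval x)\<^sup>2 \<le> r" "k * (absval y)\<^sup>2 \<le> r" "0 \<le> k"
  shows "k * (absval (x + y))\<^sup>2 \<le> r"
proof -
  have "(absval (x + y))\<^sup>2 \<le> (max (absval x) (absval y))\<^sup>2"
    by (intro power_mono absval_ultrametric absval_nonneg)
  then have "k * (absval (x + y))\<^sup>2 \<le> k * (max (absval x) (absval y))\<^sup>2"
    using assms(3) by (rule mult_left_mono)
  also have "\<dots> \<le> r"
    using assms by (simp add: max_def)
  finally show ?thesis .
qed

text \<open>A bound on the norm splits into separate bounds on the two coordinates, and each of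
  these survives addition. Thus the absolute value of the norm is itself ultrametric on E.\<close>

lemma absval_det_ext_E_add:
  fixes \<pi> :: "'a::p_adic_field"
  assumes u: "uniformizer \<pi>" and A: "A \<in> ext_E \<pi>" and B: "B \<in> ext_E \<pi>"
    and r: "absval (det A) \<le> r" "absval (det B) \<le> r"
  shows "A + B \<in> ext_E \<pi>" "absval (det (A + B)) \<le> r"
proof -
  show AB: "A + B \<in> ext_E \<pi>"
    using A B by (simp add: ext_E_iff algebra_simps)
  show "absval (det (A + B)) \<le> r"
    using r absval_power2_add_le[of 1 "A$1$1" r "B$1$1"]
      absval_power2_add_le[of "absval \<pi>" "A$1$2" r "B$1$2"]
    by (simp add: absval_det_ext_E_le_iff[OF u] A B AB absval_nonneg)
qed

lemma absval_det_ext_E_sum: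
  fixes \<pi> :: "'a::p_adic_field"
  assumes u: "uniformizer \<pi>" and "finite I" and "0 \<le> r"
    and "\<And>i. i \<in> I \<Longrightarrow> f i \<in> ext_E \<pi> \<and> absval (det (f i)) \<le> r"
  shows "sum f I \<in> ext_E \<pi> \<and> absval (det (sum f I)) \<le> r"
  using assms(2,4)
proof (induction I)
  case empty
  then show ?case using \<open>0 \<le> r\<close> by (simp add: ext_E_iff det_2)
next
  case (insert i I)
  then show ?case using absval_det_ext_E_add[OF u, of "f i" "sum f I" r] by simp
qed

text \<open>In an integral equation for an element of norm larger than 1, the leading power would
  dominate: the lower terms, and so their sum, have norm at most that of the power
  \<open>n - 1\<close>.\<close>

lemma absval_det_int_ring_E:
  fixes \<pi> :: "'a::p_adic_field"
  assumes u: "uniformizer \<pi>" and A: "A \<in> int_ring_E \<pi>"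
  shows "absval (det A) \<le> 1"
proof (rule ccontr)
  assume "\<not> ?thesis"
  then have gt: "1 < absval (det A)" by simp
  have AE: "A \<in> ext_E \<pi>"
    using A by (simp add: int_ring_E_def)
  obtain n c where c: "\<And>i. i < n \<Longrightarrow> absval (c i) \<le> 1"
    and eq: "(((**) A) ^^ n) (mat 1) + (\<Sum>i<n. mat (c i) ** (((**) A) ^^ i) (mat 1)) = 0"
    using A by (auto simp: int_ring_E_def integral_over_int_ring_def int_ring_def)
  define T where "T = (\<Sum>i<n. mat (c i) ** (((**) A) ^^ i) (mat 1))"
  \<comment> \<open>The definition of integrality admits degree 0, whose equation reads 1 = 0.
    Excluding it makes \<open>n - 1\<close> a true predecessor.\<close>
  have "n \<noteq> 0"
  proof
    assume "n = 0"
    with eq have "(mat 1 :: 'a mat22) = 0" by simp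
    then show False by (simp add: mat22_eq_iff mat_nth)
  qed
  have "T \<in> ext_E \<pi> \<and> absval (det T) \<le> absval (det A) ^ (n - 1)"
    unfolding T_def
  proof (rule absval_det_ext_E_sum[OF u])
    fix i assume "i \<in> {..<n}"
    then have i: "i < n" by simp
    have "mat (c i) \<in> ext_E \<pi>"
      by (simp add: ext_E_iff mat_nth)
    moreover have "absval (det (mat (c i) :: 'a mat22)) \<le> 1"
      using c[OF i] by (simp add: det_2 mat_nth absval_mult mult_le_one absval_nonneg)
    moreover have "absval (det A) ^ i \<le> absval (det A) ^ (n - 1)"
      using gt i by (intro power_increasing) auto
    ultimately show "mat (c i) ** (((**) A) ^^ i) (mat 1) \<in> ext_E \<pi> \<and>
        absval (det (mat (c i) ** (((**) A) ^^ i) (mat 1))) \<le> absval (det A) ^ (n - 1)"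
      using mult_mono[of "absval (det (mat (c i) :: 'a mat22))" 1
          "absval (det A) ^ i" "absval (det A) ^ (n - 1)"]
      by (simp add: ext_E_mult ext_E_power AE det_mul det_matrix_power absval_mult absval_power
          absval_nonneg)
  qed (simp_all add: absval_nonneg)
  moreover have "det T = det A ^ n"
  proof -
    \<comment> \<open>The sign is harmless, since negating a matrix of size 2 leaves its determinant
      unchanged.\<close>
    have "T = - (((**) A) ^^ n) (mat 1)"
      using eq by (simp add: T_def eq_neg_iff_add_eq_0 add.commute)
    then show ?thesis
      unfolding det_matrix_power[symmetric] by (simp add: det_2)
  qed
  ultimately have "absval (det A) ^ n \<le> absval (det A) ^ (n - 1)"
    by (simp add: absval_power)
  then show False
    using gt \<open>n \<noteq> 0\<close> by simp
qed

text \<open>The norms of the unit and of its inverse are both at most 1 and multiply to 1. The entry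
  bounds then follow from the formula for the norm as a maximum.\<close>

lemma int_units_E_props:
  fixes \<pi> :: "'a::p_adic_field"
  assumes u: "uniformizer \<pi>" and "A \<in> int_units_E \<pi>"
  shows "A \<in> ext_E \<pi>" "absval (det A) = 1" "absval (A$1$1) \<le> 1" "absval (A$1$2) \<le> 1"
proof -
  obtain B where A: "A \<in> int_ring_E \<pi>" and B: "B \<in> int_ring_E \<pi>" and AB: "A ** B = mat 1"
    using assms(2) by (auto simp: int_units_E_def Units_def mult_monoid_def)
  show AE: "A \<in> ext_E \<pi>"
    using A by (simp add: int_ring_E_def)
  have "det A * det B = 1"
    using AB by (simp flip: det_mul)
  then have "absval (det A) * absval (det B) = 1"
    by (simp flip: absval_mult)
  then show det: "absval (det A) = 1"
    using absval_det_int_ring_E[OF u A] absval_det_int_ring_E[OF u B]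
      mult_left_le[of "absval (det B)" "absval (det A)"] absval_nonneg[of "det A"] by auto
  then have le: "(absval (A$1$1))\<^sup>2 \<le> 1" "absval \<pi> * (absval (A$1$2))\<^sup>2 \<le> 1"
    using absval_det_ext_E_le_iff[OF u AE, of 1] by auto
  show "absval (A$1$1) \<le> 1"
    using le(1) absval_nonneg by (simp add: abs_square_le_1)
  show "absval (A$1$2) \<le> 1"
  proof (rule ccontr)
    let ?y = "A$1$2"
    assume "\<not> absval ?y \<le> 1"
    then have y: "1 < absval ?y" by simp
    \<comment> \<open>The norm alone bounds \<open>absval \<pi>\<close> times a square, which is too
      weak. Discreteness closes the gap: the inverse of \<open>?y\<close> lies in \<pp>, so its
      absolute value is at most that of \<pi>.\<close>
    then have "absval (1 / ?y) \<le> absval \<pi>"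
      by (intro uniformizer_absval(3)[OF u]) (simp add: absval_divide)
    then have "1 \<le> absval \<pi> * absval ?y"
      using y by (simp add: absval_divide field_simps)
    also have "\<dots> < absval \<pi> * (absval ?y)\<^sup>2"
      using y uniformizer_absval(1)[OF u] by (simp add: power2_eq_square)
    finally show False using le(2) by simp
  qed
qed

section \<open>The support C and twisted conjugacy\<close>

lemma absval_diff_less: "absval x < r \<Longrightarrow> absval y < r \<Longrightarrow> absval (x - y) < r"
  for x y :: "'a::p_adic_field"
  using absval_diff[of x y] by simp

lemma absval_add_less: "absval x < r \<Longrightarrow> absval y < r \<Longrightarrow> absval (x + y) < r"
  for x y :: "'a::p_adic_field"
  using absval_ultrametric[of x y] by simp

lemma absval_mult_less_1:
  "absval x \<le> 1 \<Longrightarrow> absval y < 1 \<Longrightarrow> absval (x * y) < 1"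
  for x y :: "'a::p_adic_field"
  using mult_right_mono[of "absval x" 1 "absval y"] absval_nonneg[of y]
  by (simp add: absval_mult)

lemma I1_props:
  fixes A :: "'a::p_adic_field mat22"
  assumes "A \<in> I1"
  shows "absval (A$1$1 - A$2$2) < 1" "absval (A$1$2) \<le> 1" "absval (A$2$1) < 1"
    "absval (det A) = 1"
proof -
  obtain a b c d where A: "A = mat2 a b c d"
    and a: "absval (a - 1) < 1" and b: "absval b \<le> 1" and c: "absval c < 1"
    and d: "absval (d - 1) < 1"
    using assms by (auto simp: I1_def max_ideal_def int_ring_def)
  show "absval (A$1$1 - A$2$2) < 1"
    using absval_diff_less[OF a d] by (simp add: A)
  show "absval (A$1$2) \<le> 1" "absval (A$2$1) < 1"
    using b c by (simp_all add: A)
  have d1: "absval d \<le> 1"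
    using absval_ultrametric[of "d - 1" 1] d by simp
  have "absval (d * (a - 1) + (d - 1) - b * c) < 1"
    using absval_diff_less[OF absval_add_less[OF absval_mult_less_1[OF d1 a] d]
        absval_mult_less_1[OF b c]] .
  moreover have "det A - 1 = d * (a - 1) + (d - 1) - b * c"
    by (simp add: A det_2 algebra_simps)
  ultimately have "absval (det A - 1) < absval (1::'a)" by (simp only: absval_1)
  then show "absval (det A) = 1"
    using absval_diff_eq(1)[of "1 - det A" 1] absval_minus[of "det A - 1"] by simp
qed

lemma C0_props:
  fixes \<pi> :: "'a::p_adic_field"
  assumes u: "uniformizer \<pi>" and "L \<subseteq> I1" and "Y \<in> C0 \<pi> L"
  shows "absval (det Y) = 1" "absval (Y$1$1 - Y$2$2) < 1"
proof -
  obtain e l where e: "e \<in> int_units_E \<pi>" and l: "l \<in> I1" and Y: "Y = e ** l"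
    using assms(2,3) by (auto simp: C0_def set_mult_def GL2_def mult_monoid_def)
  note e' = int_units_E_props[OF u e] and l' = I1_props[OF l]
  show "absval (det Y) = 1"
    by (simp add: Y det_mul absval_mult e' l')
  have "Y$1$1 - Y$2$2
      = e$1$1 * (l$1$1 - l$2$2) + e$1$2 * l$2$1 - (e$1$2 * l$1$2) * \<pi>"
    using e'(1) by (simp add: Y mat22_mult_nth ext_E_iff algebra_simps)
  also have "absval \<dots> < 1"
  proof (rule absval_diff_less[OF absval_add_less])
    show "absval (e$1$1 * (l$1$1 - l$2$2)) < 1"
      using e'(3) l'(1) by (rule absval_mult_less_1)
    show "absval (e$1$2 * l$2$1) < 1"
      using e'(4) l'(3) by (rule absval_mult_less_1)
    show "absval (e$1$2 * l$1$2 * \<pi>) < 1"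
      using e'(4) l'(2) uniformizer_absval(2)[OF u]
      by (intro absval_mult_less_1) (simp_all add: absval_mult mult_le_one absval_nonneg)
  qed
  finally show "absval (Y$1$1 - Y$2$2) < 1" .
qed

lemma twisted_conjugate_diagonal:
  fixes g :: "'a::field mat22" and x x' :: 'a
  defines "Y \<equiv> g ** mat2 x 0 0 x' ** vdash g"
  shows "Y$1$1 - Y$2$2 = det g * (x - x')" "det Y = (det g)\<^sup>2 * (x * x')"
  by (simp_all add: Y_def vdash_def w_def mat22_mult_nth transpose_def det_2
      power2_eq_square algebra_simps)

lemma matrix_inv_diagonal:
  fixes a d :: "'a::field"
  assumes "a \<noteq> 0" "d \<noteq> 0"
  shows "matrix_inv (mat2 a 0 0 d) = mat2 (inverse a) 0 0 (inverse d)"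
proof -
  have "invertible (mat2 a 0 0 d)"
    using assms by (simp add: invertible_det_nz det_2)
  then have "mat2 a 0 0 d ** matrix_inv (mat2 a 0 0 d) = mat 1"
    unfolding invertible_def matrix_inv_def by (rule someI2_ex) simp
  then show ?thesis
    using assms by (auto simp: mat22_eq_iff mat22_mult_nth mat_nth field_simps)
qed

theorem proposition21:
  fixes \<pi> \<alpha> :: "'a::p_adic_field" and L :: "('a mat22) set"
  assumes "uniformizer \<pi>"
    and "subgroup L GL2" and "compact L" and "openin (top_of_set (carrier GL2)) L"
    and "L \<subseteq> I1"
    and "subgroup (E_units \<pi> <#>\<^bsub>GL2\<^esub> L) GL2"
    and "\<alpha> \<in> int_units"
    and "\<alpha> - 1 \<notin> \<pp>" and "\<alpha> + 1 \<notin> \<pp>"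
  shows "\<not> (\<exists>Y \<in> C \<pi> L. eps_conjugate (matrix_inv (S (mat2 \<alpha> 0 0 (inverse \<alpha>)))) Y)"
proof
  note u = \<open>uniformizer \<pi>\<close>
  assume "\<exists>Y \<in> C \<pi> L. eps_conjugate (matrix_inv (S (mat2 \<alpha> 0 0 (inverse \<alpha>)))) Y"
  then obtain Y g where Y: "Y \<in> C \<pi> L"
    and conj: "Y = g ** matrix_inv (S (mat2 \<alpha> 0 0 (inverse \<alpha>))) ** vdash g"
    by (auto simp: eps_conjugate_def)
  have \<alpha>: "absval \<alpha> = 1"
    using absval_int_units assms(7) .
  have m: "absval (\<alpha> - 1) = 1" and p: "absval (\<alpha> + 1) = 1"
    using assms(8,9) absval_diff[of \<alpha> 1] absval_ultrametric[of \<alpha> 1] \<alpha>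
    by (auto simp: max_ideal_def)
  have nz: "\<alpha> \<noteq> 0" "\<alpha> - 1 \<noteq> 0" "inverse \<alpha> - 1 \<noteq> 0"
    using \<alpha> m by (auto simp: inverse_eq_1_iff simp flip: absval_pos_iff)
  define x x' where "x = inverse (\<alpha> - 1)" and "x' = inverse (inverse \<alpha> - 1)"
  have "S (mat2 \<alpha> 0 0 (inverse \<alpha>)) = mat2 (\<alpha> - 1) 0 0 (inverse \<alpha> - 1)"
    by (simp add: S_def mat22_eq_iff mat_nth)
  then have Yg: "Y = g ** mat2 x 0 0 x' ** vdash g"
    using conj nz by (simp add: matrix_inv_diagonal x_def x'_def)
  have x'_eq: "x' = - \<alpha> / (\<alpha> - 1)"
    using nz by (simp add: x'_def divide_simps) (simp add: algebra_simps)
  have "x - x' = (\<alpha> + 1) / (\<alpha> - 1)"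
    by (simp add: x'_eq x_def divide_simps)
  then have diag: "absval (Y$1$1 - Y$2$2) = absval (det g)"
    by (simp add: Yg twisted_conjugate_diagonal absval_mult absval_divide m p)
  have "absval (x * x') = 1"
    using m \<alpha> absval_divide[of 1 "\<alpha> - 1"]
    by (simp add: x'_eq x_def absval_mult absval_divide inverse_eq_divide)
  then have det: "absval (det Y) = (absval (det g))\<^sup>2"
    by (simp add: Yg twisted_conjugate_diagonal absval_mult absval_power)
  from Y consider "Y \<in> C0 \<pi> L" | Z where "Z \<in> C0 \<pi> L" "Y = varpi_E \<pi> ** Z"
    by (auto simp: C_def l_coset_def GL2_def mult_monoid_def)
  then show False
  proof cases
    case 1
    then have "(absval (det g))\<^sup>2 = 1" "absval (det g) < 1"
      using C0_props[OF u assms(5) 1] det unfolding diag by auto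
    then show False
      using absval_nonneg[of "det g"] by (simp add: power2_eq_1_iff)
  next
    case 2
    have "absval (det (varpi_E \<pi>)) = absval \<pi>"
      by (simp add: varpi_E_def det_2)
    then have "absval (det Y) = absval \<pi>"
      using C0_props(1)[OF u assms(5) 2(1)] by (simp add: 2(2) det_mul absval_mult)
    then show False
      using absval_power2_neq_uniformizer[OF u] det by metis
  qed
qed

end
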